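(* Let $n = 2p+q$, where $p$ is a prime and $q$ is an odd prime. Then the ladder $L_n = P_2 \times P_n$ has a prime labeling.
   Context: A prime labeling of a graph of order $m$ is a bijective assignment of the integers $\{1,2,\ldots,m\}$ to the vertices such that every pair of adjacent vertices receives coprime labels. The ladder $L_n = P_2 \times P_n$ (of order $2n$) is the $2\times n$ grid graph, i.e. the Cartesian product of a path on $2$ vertices with a path on $n$ vertices. *)

theory Defs
  imports
    "HOL-Computational_Algebra.Primes"
    "Graph_Theory.Pair_Digraph"
begin

text \<open>
  As usual for \<^theory>\<open>Graph_Theory.Pair_Digraph\<close>, a finite simple graph is a finite symmetric
  loop-free digraph without parallel arcs (\<^locale>\<open>pair_graph\<close>): an edge between \<open>u\<close> and \<open>v\<close>
  is the pair of arcs \<open>(u, v)\<close> and \<open>(v, u)\<close>.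
\<close>

definition path_graph :: "nat \<Rightarrow> nat pair_pre_digraph" where
  "path_graph n =
     \<lparr> pverts = {..<n},
       parcs = {(i, j). i < n \<and> j < n \<and> (j = Suc i \<or> i = Suc j)} \<rparr>"

definition cartesian_product ::
    "'a pair_pre_digraph \<Rightarrow> 'b pair_pre_digraph \<Rightarrow> ('a \<times> 'b) pair_pre_digraph" where
  "cartesian_product G H =
     \<lparr> pverts = pverts G \<times> pverts H,
       parcs = {((a, x), (b, y)) | a b x y.
                  a = b \<and> a \<in> pverts G \<and> (x, y) \<in> parcs H \<or>
                  (a, b) \<in> parcs G \<and> x = y \<and> x \<in> pverts H} \<rparr>"

definition ladder :: "nat \<Rightarrow> (nat \<times> nat) pair_pre_digraph" where
  "ladder n = cartesian_product (path_graph 2) (path_graph n)"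

definition prime_labeling :: "'a pair_pre_digraph \<Rightarrow> ('a \<Rightarrow> nat) \<Rightarrow> bool" where
  "prime_labeling G f \<longleftrightarrow>
     bij_betw f (pverts G) {1..card (pverts G)} \<and>
     (\<forall>(u, v) \<in> parcs G. coprime (f u) (f v))"

lemma pair_graph_path_graph: "pair_graph (path_graph n)"
proof
  show "finite (parcs (path_graph n))"
    by (rule finite_subset[of _ "{..<n} \<times> {..<n}"]) (auto simp: path_graph_def)
  show "symmetric (with_proj (path_graph n))"
    by (auto simp: symmetric_def path_graph_def intro!: symI)
qed (auto simp: path_graph_def)

lemma pair_graph_cartesian_product:
  assumes "pair_graph G" "pair_graph H"
  shows "pair_graph (cartesian_product G H)"
proof -
  interpret G: pair_graph G by fact
  interpret H: pair_graph H by fact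
  have sub: "parcs (cartesian_product G H) \<subseteq>
      (pverts G \<times> pverts H) \<times> (pverts G \<times> pverts H)"
    by (auto simp: cartesian_product_def
        dest: G.in_arcsD1 G.in_arcsD2 H.in_arcsD1 H.in_arcsD2)
  have fin: "finite (pverts G \<times> pverts H)"
    using G.pair_finite_verts H.pair_finite_verts by simp
  have sG: "sym (parcs G)" and sH: "sym (parcs H)"
    using G.pair_sym_arcs H.pair_sym_arcs by (simp_all add: symmetric_def)
  show ?thesis
  proof
    show "finite (pverts (cartesian_product G H))"
      using fin by (simp add: cartesian_product_def)
    show "finite (parcs (cartesian_product G H))"
      using sub fin by (meson finite_SigmaI finite_subset)
    show "symmetric (with_proj (cartesian_product G H))"
      using sG sH by (auto simp: symmetric_def cartesian_product_def intro!: symI dest: symD)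
    fix e assume e: "e \<in> parcs (cartesian_product G H)"
    show "fst e \<in> pverts (cartesian_product G H)" "snd e \<in> pverts (cartesian_product G H)"
      using e by (auto simp: cartesian_product_def
          dest: G.in_arcsD1 G.in_arcsD2 H.in_arcsD1 H.in_arcsD2)
    show "fst e \<noteq> snd e"
      using e G.pair_no_loops H.pair_no_loops by (fastforce simp: cartesian_product_def)
  qed
qed

lemma pair_graph_ladder: "pair_graph (ladder n)"
  unfolding ladder_def by (intro pair_graph_cartesian_product pair_graph_path_graph)

lemma card_pverts_ladder: "card (pverts (ladder n)) = 2 * n"
  by (simp add: ladder_def cartesian_product_def path_graph_def)

end

theory Submission
  imports Defs
begin

text \<open>
  Cut the ladder into three consecutive blocks with odd numbers \<open>a\<close>, \<open>b\<close>, \<open>c\<close> of columns and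
  label both rows of each block with consecutive integers, so that the two labels in a column of a
  block differ by \<open>a\<close>, \<open>b\<close> or \<open>c\<close> respectively. Take these from \<open>p\<close>, \<open>p\<close>, \<open>q\<close>,
  giving the smallest labels to the smaller prime. The middle block, which is traversed backwards,
  then meets its neighbours in coprime labels as well, and the only conflicts are in the columns
  consisting of two multiples of the block length. Each of these columns contains \<open>2p\<close>, \<open>4p\<close>, or a
  small even multiple of \<open>q\<close>.

  Every edge joins an even and an odd label, and powers of \<open>2\<close> are coprime to all odd
  labels. So the conflicts are resolved by permuting a few even labels: \<open>2\<close> and \<open>4\<close> (or \<open>8\<close>) move to
  places whose neighbours are hard to control, and the multiples of \<open>p\<close> and \<open>q\<close> move to places
  whose neighbours are explicit and smaller than twice the prime in question.
  Which permutation works depends on the relative size of \<open>p\<close> and \<open>q\<close> and on coincidences such as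
  \<open>p = 2q - 1\<close> or \<open>p = q + 4\<close>. The case \<open>p = 2\<close> and finitely many small \<open>n\<close> use other
  block lengths.
\<close>

section \<open>The block labeling\<close>

text \<open>Running the middle block backwards puts \<open>1\<close> and \<open>b + 1\<close> at the
  seam with the right block, where both edges are coprime for all lengths; \<open>b\<close> and
  \<open>2 * b\<close> face the left block.\<close>

definition block_label :: "nat \<Rightarrow> nat \<Rightarrow> nat \<Rightarrow> nat \<times> nat \<Rightarrow> nat" where
  "block_label a b c = (\<lambda>(r, j).
     if j < a then 2 * b + 2 * c + 1 + j + (if r = 0 then a else 0)
     else if j < a + b then a + b - j + (if r = 0 then 0 else b)
     else 2 * b + 1 + (j - a - b) + (if r = 0 then c else 0))"

text \<open>
  \<open>block_arc a b c x y\<close>: the labels \<open>x\<close> and \<open>y\<close> sit on adjacent vertices. The last four rules are the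
  horizontal edges between different blocks.
\<close>

inductive block_arc :: "nat \<Rightarrow> nat \<Rightarrow> nat \<Rightarrow> nat \<Rightarrow> nat \<Rightarrow> bool" for a b c where
  run: "0 < x \<Longrightarrow> x \<notin> {b, 2 * b, 2 * b + c, 2 * b + 2 * c, 2 * b + 2 * c + a, 2 * (a + b + c)} \<Longrightarrow>
    block_arc a b c x (Suc x)"
| shift_b: "0 < x \<Longrightarrow> x \<le> b \<Longrightarrow> block_arc a b c x (x + b)"
| shift_c: "2 * b < x \<Longrightarrow> x \<le> 2 * b + c \<Longrightarrow> block_arc a b c x (x + c)"
| shift_a: "2 * b + 2 * c < x \<Longrightarrow> x \<le> 2 * b + 2 * c + a \<Longrightarrow> block_arc a b c x (x + a)"
| bc_top: "block_arc a b c 1 (2 * b + c + 1)"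
| bc_bottom: "block_arc a b c (b + 1) (2 * b + 1)"
| ab_top: "block_arc a b c b (2 * (a + b + c))"
| ab_bottom: "block_arc a b c (2 * b) (2 * b + 2 * c + a)"

definition block_adj :: "nat \<Rightarrow> nat \<Rightarrow> nat \<Rightarrow> nat \<Rightarrow> nat \<Rightarrow> bool" where
  "block_adj a b c x y \<longleftrightarrow> block_arc a b c x y \<or> block_arc a b c y x"

section \<open>Edges of the ladder in terms of labels\<close>

lemma ladder_verts: "pverts (ladder n) = {..<2} \<times> {..<n}"
  by (simp add: ladder_def cartesian_product_def path_graph_def)

lemma ladder_arcsE:
  assumes "(u, v) \<in> parcs (ladder n)"
  obtains r j where "r < 2" "Suc j < n" "{u, v} = {(r, j), (r, Suc j)}"
    | j where "j < n" "{u, v} = {(0, j), (1, j)}"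
  using assms
  by (auto simp: ladder_def cartesian_product_def path_graph_def less_2_cases_iff insert_commute)

lemma bij_block_label:
  "bij_betw (block_label a b c) (pverts (ladder (a + b + c))) {1..2 * (a + b + c)}"
proof -
  let ?V = "pverts (ladder (a + b + c))"
  have inj: "inj_on (block_label a b c) ?V"
    unfolding inj_on_def ladder_verts
    by (auto simp: block_label_def less_2_cases_iff split: if_splits)
  have sub: "block_label a b c ` ?V \<subseteq> {1..2 * (a + b + c)}"
    unfolding ladder_verts by (auto simp: block_label_def less_2_cases_iff)
  have "card (block_label a b c ` ?V) = card {1..2 * (a + b + c)}"
    using card_image[OF inj] by (simp add: card_pverts_ladder)
  with sub have "block_label a b c ` ?V = {1..2 * (a + b + c)}"
    by (intro card_subset_eq) auto
  with inj show ?thesis by (simp add: bij_betw_def)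
qed

lemma block_adj_column:
  assumes "j < a + b + c"
  shows "block_adj a b c (block_label a b c (0, j)) (block_label a b c (1, j))"
proof -
  consider "j < a" | "a \<le> j" "j < a + b" | "a + b \<le> j" by linarith
  then show ?thesis
  proof cases
    case 1
    then show ?thesis
      using shift_a[of b c "2 * b + 2 * c + 1 + j" a]
      by (simp add: block_adj_def block_label_def add_ac)
  next
    case 2
    then show ?thesis
      using shift_b[of "a + b - j" b a c] by (simp add: block_adj_def block_label_def)
  next
    case 3
    then show ?thesis
      using shift_c[of b "2 * b + 1 + (j - a - b)" c a] assms
      by (simp add: block_adj_def block_label_def add_ac)
  qed
qed

lemma block_adj_row:
  assumes "Suc j < a + b + c" "r < 2" "0 < a" "0 < b" "0 < c"
  shows "block_adj a b c (block_label a b c (r, j)) (block_label a b c (r, Suc j))"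
proof -
  \<comment> \<open>Adding \<open>t a\<close> selects the row, so that one instance of
    \<open>run\<close> serves both rows of the left block.\<close>
  define t where "t m = (if r = 0 then m else 0)" for m :: nat
  consider "Suc j < a" | "Suc j = a" | "a \<le> j" "Suc j < a + b" | "Suc j = a + b" | "a + b \<le> j"
    by linarith
  then show ?thesis
  proof cases
    case 1
    then show ?thesis
      using run[of "2 * b + 2 * c + 1 + j + t a" b c a]
      by (simp add: block_adj_def block_label_def t_def)
  next
    case 2
    then show ?thesis
      using ab_top[of a b c] ab_bottom[of a b c] assms
      by (auto simp: block_adj_def block_label_def add_ac mult_2)
  next
    case 3
    define i where "i = a + b - Suc j"
    have i: "0 < i" "i < b" "a + b - Suc j = i" "a + b - j = Suc i"
      using 3 by (auto simp: i_def)
    have "block_arc a b c i (Suc i)" "block_arc a b c (i + b) (Suc (i + b))"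
      using i(1,2) assms(3-5) by (auto intro!: run)
    then show ?thesis
      using 3 i by (simp add: block_adj_def block_label_def)
  next
    case 4
    then have "a + b - j = 1" "\<not> j < a" "j < a + b" using assms(4) by auto
    then show ?thesis
      using 4 bc_top[of a b c] bc_bottom[of a b c]
      by (auto simp: block_adj_def block_label_def)
  next
    case 5
    then obtain k where k: "j = a + b + k" by (auto simp: le_iff_add)
    have "block_arc a b c (2 * b + 1 + k) (Suc (2 * b + 1 + k))"
      "block_arc a b c (2 * b + 1 + k + c) (Suc (2 * b + 1 + k + c))"
      using k assms by (auto intro!: run)
    then show ?thesis
      using k by (simp add: block_adj_def block_label_def)
  qed
qed

text \<open>Shifts by \<open>1\<close> or by an odd block length change parity, and so does each of
  the four seam edges.\<close>

lemma odd_block_arc: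
  assumes "block_arc a b c x y" "odd a" "odd b" "odd c"
  shows "odd (x + y)"
  using assms by cases auto

lemma even_block_adj:
  assumes "block_adj a b c x y" "odd a" "odd b" "odd c" "even x"
  shows "odd y"
  using assms odd_block_arc unfolding block_adj_def by fastforce

text \<open>In \<open>ps\<close>, a pair \<open>(x, v)\<close> means that the vertex labeled \<open>x\<close> is relabeled \<open>v\<close>.\<close>

lemma block_labeling:
  fixes ps :: "(nat \<times> nat) list"
  assumes odd: "odd a" "odd b" "odd c"
    and dist: "distinct (map fst ps)"
    and perm: "set (map snd ps) = set (map fst ps)"
    and range: "\<And>x. x \<in> set (map fst ps) \<Longrightarrow> even x \<and> 0 < x \<and> x \<le> 2 * (a + b + c)"
    and moved: "\<And>x v y. (x, v) \<in> set ps \<Longrightarrow> block_adj a b c x y \<Longrightarrow> coprime v y"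
    and fixed: "\<And>x y. x \<notin> set (map fst ps) \<Longrightarrow> y \<notin> set (map fst ps) \<Longrightarrow>
        block_arc a b c x y \<Longrightarrow> coprime x y"
  shows "\<exists>f. prime_labeling (ladder (a + b + c)) f"
proof -
  define D where "D = set (map fst ps)"
  define \<pi> where "\<pi> x = (case map_of ps x of None \<Rightarrow> x | Some v \<Rightarrow> v)" for x
  have \<pi>_in: "\<pi> x = v" if "(x, v) \<in> set ps" for x v
    using that dist by (simp add: \<pi>_def)
  have \<pi>_out: "\<pi> x = x" if "x \<notin> D" for x
  proof -
    have "map_of ps x = None" using that by (simp add: D_def map_of_eq_None_iff)
    then show ?thesis by (simp add: \<pi>_def)
  qed
  have img: "\<pi> ` D = D"
  proof -
    have "\<pi> ` D = snd ` set ps"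
      using \<pi>_in by (force simp: D_def image_image intro!: image_cong)
    with perm show ?thesis by (simp add: D_def)
  qed
  have D: "D \<subseteq> {1..2 * (a + b + c)}" using range by (fastforce simp: D_def)
  \<comment> \<open>\<open>\<pi>\<close> maps both \<open>D\<close> and its complement onto
    themselves; on a finite set surjectivity also gives injectivity.\<close>
  have surj: "\<pi> ` {1..2 * (a + b + c)} = {1..2 * (a + b + c)}"
  proof -
    have "{1..2 * (a + b + c)} = D \<union> ({1..2 * (a + b + c)} - D)" using D by auto
    moreover have "\<pi> ` ({1..2 * (a + b + c)} - D) = {1..2 * (a + b + c)} - D"
      using \<pi>_out by auto
    ultimately show ?thesis by (metis image_Un img)
  qed
  have "bij_betw \<pi> {1..2 * (a + b + c)} {1..2 * (a + b + c)}"
    using surj by (simp add: bij_betw_def eq_card_imp_inj_on)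
  with bij_block_label have bij:
    "bij_betw (\<pi> \<circ> block_label a b c) (pverts (ladder (a + b + c))) {1..2 * (a + b + c)}"
    by (rule bij_betw_trans)
  \<comment> \<open>Moved labels are even and their neighbours odd, so no edge has both ends in
    \<open>D\<close>.\<close>
  have D_adj: "coprime (\<pi> x) (\<pi> y)" if xy: "block_adj a b c x y" and x: "x \<in> D" for x y
  proof -
    obtain v where v: "(x, v) \<in> set ps" using x by (auto simp: D_def)
    have "even x" using range x by (simp add: D_def)
    then have "odd y" using even_block_adj xy odd by blast
    then have "y \<notin> D" using range unfolding D_def by blast
    then show ?thesis using moved[OF v xy] \<pi>_in[OF v] \<pi>_out by simp
  qed
  have adj: "coprime (\<pi> x) (\<pi> y)" if "block_arc a b c x y" for x y
    using that D_adj[of x y] D_adj[of y x] fixed[of x y] \<pi>_out[of x] \<pi>_out[of y]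
    unfolding block_adj_def D_def[symmetric] by (metis coprime_commute)
  have adj': "coprime (\<pi> x) (\<pi> y) \<and> coprime (\<pi> y) (\<pi> x)" if "block_adj a b c x y" for x y
    using that adj unfolding block_adj_def by (metis coprime_commute)
  have pos: "0 < a" "0 < b" "0 < c" using odd by (auto elim: oddE)
  have "coprime ((\<pi> \<circ> block_label a b c) u) ((\<pi> \<circ> block_label a b c) v)"
    if "(u, v) \<in> parcs (ladder (a + b + c))" for u v
    using that
  proof (cases rule: ladder_arcsE)
    case (1 r j)
    then show ?thesis
      using adj'[OF block_adj_row[OF _ _ pos, of j r]] by (auto simp: doubleton_eq_iff)
  next
    case (2 j)
    then show ?thesis
      using adj'[OF block_adj_column[of j]] by (auto simp: doubleton_eq_iff)
  qed
  with bij show ?thesis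
    unfolding prime_labeling_def by (intro exI[of _ "\<pi> \<circ> block_label a b c"])
      (auto simp: card_pverts_ladder)
qed

text \<open>Runs and the seam with the right block never conflict, so hypotheses are left only for
  columns and the seam with the left block. A column \<open>x\<close>, \<open>x + m\<close> is
  coprime exactly when \<open>x\<close> and \<open>m\<close> are; in each bad column it suffices to
  move one member.\<close>

lemma prime_labelingI_shifts:
  fixes ps :: "(nat \<times> nat) list"
  defines "S \<equiv> set (map fst ps)"
  assumes odd: "odd a" "odd b" "odd c"
    and dist: "distinct (map fst ps)"
    and perm: "set (map snd ps) = S"
    and range: "\<And>x. x \<in> S \<Longrightarrow> even x \<and> 0 < x \<and> x \<le> 2 * (a + b + c)"
    and moved: "\<And>x v y. (x, v) \<in> set ps \<Longrightarrow> block_adj a b c x y \<Longrightarrow> odd y \<Longrightarrow> coprime v y"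
    and b: "\<And>x. 0 < x \<Longrightarrow> x \<le> b \<Longrightarrow> \<not> coprime x b \<Longrightarrow> x \<in> S \<or> x + b \<in> S"
    and c: "\<And>x. 2 * b < x \<Longrightarrow> x \<le> 2 * b + c \<Longrightarrow> \<not> coprime x c \<Longrightarrow> x \<in> S \<or> x + c \<in> S"
    and a: "\<And>x. 2 * b + 2 * c < x \<Longrightarrow> x \<le> 2 * b + 2 * c + a \<Longrightarrow> \<not> coprime x a \<Longrightarrow>
      x \<in> S \<or> x + a \<in> S"
    and top: "coprime b (a + c) \<or> 2 * (a + b + c) \<in> S"
    and bottom: "coprime (2 * b) (2 * b + 2 * c + a) \<or> 2 * b \<in> S"
  shows "\<exists>f. prime_labeling (ladder (a + b + c)) f"
proof (rule block_labeling[OF odd dist])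
  have add_self: "coprime x (x + m) \<longleftrightarrow> coprime x m" for x m :: nat
    by (simp add: coprime_iff_gcd_eq_1)
  show "set (map snd ps) = set (map fst ps)" using perm by (simp add: S_def)
  show "even x \<and> 0 < x \<and> x \<le> 2 * (a + b + c)" if "x \<in> set (map fst ps)" for x
    using range that by (simp add: S_def)
  show "coprime v y" if "(x, v) \<in> set ps" "block_adj a b c x y" for x v y
  proof -
    have "even x" using range that(1) by (force simp: S_def)
    then show ?thesis using moved that even_block_adj odd by blast
  qed
  show "coprime x y"
    if "x \<notin> set (map fst ps)" "y \<notin> set (map fst ps)" "block_arc a b c x y" for x y
    using that(3)
  proof cases
    case run
    then show ?thesis by simp
  next
    case shift_b
    then show ?thesis using b[of x] that(1,2) by (auto simp: S_def add_self)
  next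
    case shift_c
    then show ?thesis using c[of x] that(1,2) by (auto simp: S_def add_self)
  next
    case shift_a
    then show ?thesis using a[of x] that(1,2) by (auto simp: S_def add_self)
  next
    case bc_top
    then show ?thesis by simp
  next
    case bc_bottom
    then show ?thesis using add_self[of "b + 1" b] by (simp add: mult_2)
  next
    case ab_top
    have "coprime b (2 * (a + b + c))" if "coprime b (a + c)"
      using that odd add_self[of b "a + c"]
      unfolding coprime_mult_right_iff by (simp add: add_ac)
    then show ?thesis using ab_top top that(1,2) by (auto simp: S_def)
  next
    case ab_bottom
    then show ?thesis using bottom that(1,2) by (auto simp: S_def)
  qed
qed

section \<open>Multiples of a prime\<close>

lemma not_dvd_less_double:
  fixes p y :: nat
  assumes "0 < y" "y < 2 * p" "y \<noteq> p"
  shows "\<not> p dvd y"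
proof
  assume "p dvd y"
  then obtain k where "y = p * k" by blast
  with assms have "0 < k" "k < 2" "k \<noteq> 1" by auto
  then show False by simp
qed

text \<open>For distinct primes the largest label, \<open>2 * (2 * p + q)\<close>, is less than six
  times the larger prime, so five multiples suffice.\<close>

lemma small_multiples:
  fixes p x :: nat
  assumes "p dvd x" "0 < x" "x < 6 * p"
  shows "x \<in> {p, 2 * p, 3 * p, 4 * p, 5 * p}"
proof -
  obtain k where k: "x = p * k" using assms(1) by blast
  with assms have "0 < k" "k < 6" by auto
  then have "k = 1 \<or> k = 2 \<or> k = 3 \<or> k = 4 \<or> k = 5" by linarith
  with k show ?thesis by auto
qed

lemma coprime_even_multiples:
  fixes p y :: nat
  assumes "odd y"
  shows "coprime 2 y" "coprime 4 y" "coprime 8 y"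
    and "prime p \<Longrightarrow> \<not> p dvd y \<Longrightarrow> coprime (2 * p) y"
    and "prime p \<Longrightarrow> \<not> p dvd y \<Longrightarrow> coprime (4 * p) y"
proof -
  show 2: "coprime 2 y" using assms by simp
  show 4: "coprime 4 y" using 2 coprime_power_left_iff[of 2 2 y] by simp
  show "coprime 8 y" using 2 coprime_power_left_iff[of 2 3 y] by simp
  show "coprime (2 * p) y" if "prime p" "\<not> p dvd y"
    using 2 that by (simp add: prime_imp_coprime)
  show "coprime (4 * p) y" if "prime p" "\<not> p dvd y"
    using 4 that by (simp add: prime_imp_coprime)
qed

lemma prime_dvd_if_not_coprime: "prime p \<Longrightarrow> \<not> coprime x p \<Longrightarrow> p dvd (x :: nat)"
  using prime_imp_coprime coprime_commute by blast

section \<open>The case \<open>q < p\<close>\<close>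

text \<open>With lengths \<open>p\<close>, \<open>q\<close>, \<open>p\<close> the bad columns are
  \<open>q, 2 * q\<close>, then \<open>p, 2 * p\<close> or \<open>2 * p, 3 * p\<close>, then
  \<open>3 * p, 4 * p\<close> or \<open>4 * p, 5 * p\<close>, depending on whether
  \<open>2 * q < p\<close>. Moving \<open>2 * q\<close>, \<open>2 * p\<close> and
  \<open>4 * p\<close> settles all of them.\<close>

lemma labeling_large_p_base:
  fixes p q :: nat and ps :: "(nat \<times> nat) list"
  defines "S \<equiv> set (map fst ps)"
  assumes pq: "prime p" "prime q" "odd q" "q < p"
    and dist: "distinct (map fst ps)" and perm: "set (map snd ps) = S"
    and range: "\<And>x. x \<in> S \<Longrightarrow> even x \<and> 0 < x \<and> x \<le> 4 * p"
    and S: "2 * q \<in> S" "2 * p \<in> S" "4 * p \<in> S"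
    and moved: "\<And>x v y. (x, v) \<in> set ps \<Longrightarrow> block_adj p q p x y \<Longrightarrow> odd y \<Longrightarrow> coprime v y"
  shows "\<exists>f. prime_labeling (ladder (2 * p + q)) f"
proof -
  have "odd p" using pq prime_odd_nat[of p] prime_gt_1_nat[of q] by simp
  have "\<exists>f. prime_labeling (ladder (p + q + p)) f"
  proof (rule prime_labelingI_shifts[where ps = ps])
    show "x \<in> set (map fst ps) \<or> x + q \<in> set (map fst ps)"
      if "0 < x" "x \<le> q" "\<not> coprime x q" for x
      using that small_multiples[OF prime_dvd_if_not_coprime[OF pq(2) that(3)]] S
      by (auto simp: S_def mult_2)
    show "x \<in> set (map fst ps) \<or> x + p \<in> set (map fst ps)"
      if "2 * q < x" "x \<le> 2 * q + p" "\<not> coprime x p" for x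
      using that small_multiples[OF prime_dvd_if_not_coprime[OF pq(1) that(3)]] S pq
      by (auto simp: S_def mult_2)
    show "x \<in> set (map fst ps) \<or> x + p \<in> set (map fst ps)"
      if "2 * q + 2 * p < x" "x \<le> 2 * q + 2 * p + p" "\<not> coprime x p" for x
    proof -
      have "x \<in> {3 * p, 4 * p}"
        using that small_multiples[OF prime_dvd_if_not_coprime[OF pq(1) that(3)]] pq by auto
      then have "x = 3 * p \<or> x = 4 * p" by simp
      moreover have "3 * p + p = 4 * p" by simp
      ultimately show ?thesis using S by (metis S_def)
    qed
    have "coprime q p" using pq primes_coprime[of q p] by auto
    then show "coprime q (p + p) \<or> 2 * (p + q + p) \<in> set (map fst ps)"
      using pq(3) by (simp flip: mult_2)
    show "coprime (2 * q) (2 * q + 2 * p + p) \<or> 2 * q \<in> set (map fst ps)"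
      using S by (simp add: S_def)
    show "even x \<and> 0 < x \<and> x \<le> 2 * (p + q + p)" if "x \<in> set (map fst ps)" for x
      using range[of x] that by (simp add: S_def)
  qed (use pq \<open>odd p\<close> dist perm moved in \<open>simp_all add: S_def\<close>)
  then show ?thesis by (simp add: mult_2 add_ac)
qed


section \<open>Neighbours of single labels and relabelings for \<open>q < p\<close>\<close>

lemma block_adj_lower:
  assumes "block_adj a b c x y" "1 < x" "x < b"
  shows "y \<in> {x - 1, x + 1, x + b}"
  using assms(1) unfolding block_adj_def
proof
  assume "block_arc a b c x y"
  then show ?thesis using assms(2-) by cases auto
next
  assume "block_arc a b c y x"
  then show ?thesis using assms(2-) by cases auto
qed

lemma block_adj_2b:
  assumes "block_adj a b c (2 * b) y" "1 < b" "0 < c"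
  shows "y \<in> {b, 2 * b - 1, 2 * b + 2 * c + a}"
  using assms(1) unfolding block_adj_def
proof
  assume "block_arc a b c (2 * b) y"
  then show ?thesis using assms(2-) by cases auto
next
  assume "block_arc a b c y (2 * b)"
  then show ?thesis using assms(2-) by cases auto
qed

lemma block_adj_above_2b:
  assumes "block_adj a b c x y" "2 * b + 1 < x" "x < 2 * b + c"
  shows "y \<in> {x - 1, x + 1, x + c}"
  using assms(1) unfolding block_adj_def
proof
  assume "block_arc a b c x y"
  then show ?thesis using assms(2-) by cases auto
next
  assume "block_arc a b c y x"
  then show ?thesis using assms(2-) by cases auto
qed

text \<open>\<open>2 * q\<close> and \<open>2 * q - 1\<close> lie below \<open>2 * p\<close>, so
  \<open>p\<close> could divide them only by equality, which parity and
  \<open>p + 1 \<noteq> 2 * q\<close> exclude. Dividing \<open>q\<close> or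
  \<open>2 * q + 3 * p\<close> would mean dividing \<open>2 * q\<close>.\<close>

lemma not_dvd_adj_2q:
  fixes p q :: nat
  assumes pq: "prime p" "prime q" "odd q" "q < p"
    and ne: "p + 1 \<noteq> 2 * q"
    and adj: "block_adj p q p (2 * q) y"
  shows "\<not> p dvd y"
proof -
  have q: "1 < q" using pq prime_gt_1_nat by blast
  have "odd p" using pq q prime_odd_nat[of p] by simp
  then have "2 * q \<noteq> p" by auto
  then have 2: "\<not> p dvd 2 * q" using q pq not_dvd_less_double[of "2 * q" p] by simp
  then have "\<not> p dvd 2 * q + 2 * p + p" by (simp add: add.assoc flip: distrib_right)
  moreover have "2 * q - 1 \<noteq> p" using q ne by linarith
  then have "\<not> p dvd 2 * q - 1" using q pq by (intro not_dvd_less_double) auto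
  moreover have "\<not> p dvd q" using 2 by auto
  moreover have "y \<in> {q, 2 * q - 1, 2 * q + 2 * p + p}"
    using block_adj_2b[OF adj] q pq by simp
  ultimately show ?thesis by auto
qed

text \<open>Place \<open>2\<close> has neighbours \<open>1, 3, q + 2\<close> and takes
  \<open>2 * q\<close>; place \<open>4\<close> has neighbours \<open>3, 5, q + 4\<close> and takes
  \<open>4 * p\<close>, whence the exclusion of \<open>p = q + 4\<close>.\<close>

lemma labeling_generic_large_p:
  fixes p q :: nat
  assumes pq: "prime p" "prime q" "odd q" "q < p"
    and ne: "5 \<le> q" "p \<noteq> q + 4" "p + 1 \<noteq> 2 * q"
  shows "\<exists>f. prime_labeling (ladder (2 * p + q)) f"
proof (rule labeling_large_p_base[OF pq,
      where ps = "[(2 * p, 2), (4 * p, 4), (2 * q, 2 * p), (2, 2 * q), (4, 4 * p)]"])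
  have p: "odd p" "7 \<le> p" using pq ne prime_odd_nat[of p] by (auto, presburger)
  show "coprime v y"
    if "(x, v) \<in> set [(2 * p, 2), (4 * p, 4), (2 * q, 2 * p), (2, 2 * q), (4, 4 * p)]"
      "block_adj p q p x y" and y: "odd y" for x v y
  proof -
    have "\<not> q dvd y" if "block_adj p q p 2 y"
      using block_adj_lower[OF that] ne pq not_dvd_less_double[of y q]
      by auto
    moreover have "\<not> p dvd y" if "block_adj p q p 4 y"
      using block_adj_lower[OF that] ne pq p not_dvd_less_double[of y p] by auto
    moreover have "\<not> p dvd y" if "block_adj p q p (2 * q) y"
      using not_dvd_adj_2q[OF pq ne(3) that] .
    ultimately show ?thesis
      using that pq coprime_even_multiples[OF y] by auto
  qed
qed (use assms in auto)


lemma block_adj_4_b3: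
  assumes "block_adj a 3 c 4 y" "0 < c"
  shows "y \<in> {1, 5, 7}"
  using assms(1) unfolding block_adj_def
proof
  assume "block_arc a 3 c 4 y"
  then show ?thesis using assms(2-) by cases auto
next
  assume "block_arc a 3 c y 4"
  then show ?thesis using assms(2-) by cases auto
qed

text \<open>Compared with the generic case \<open>2 * q\<close> and \<open>4 * p\<close> exchange
  places, so \<open>p\<close> has to avoid \<open>q + 2\<close> instead of \<open>q + 4\<close>. Now
  \<open>2 * q\<close> sits at \<open>4\<close>, next to \<open>5\<close>, which rules out
  \<open>q = 5\<close>; for \<open>q = 3\<close> the place \<open>4\<close> is at a seam and has
  neighbours \<open>1, 5, 7\<close>.\<close>

lemma labeling_near_large_p:
  fixes p q :: nat
  assumes pq: "prime p" "prime q" "odd q" "q < p"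
    and ne: "q \<noteq> 5" "7 \<le> p" "p \<noteq> q + 2" "p + 1 \<noteq> 2 * q"
  shows "\<exists>f. prime_labeling (ladder (2 * p + q)) f"
proof (rule labeling_large_p_base[OF pq,
      where ps = "[(2 * p, 2), (4 * p, 4), (2 * q, 2 * p), (4, 2 * q), (2, 4 * p)]"])
  have "q = 3 \<or> 7 \<le> q" using pq ne prime_gt_1_nat[of q] by (auto, presburger)
  show "coprime v y"
    if "(x, v) \<in> set [(2 * p, 2), (4 * p, 4), (2 * q, 2 * p), (4, 2 * q), (2, 4 * p)]"
      "block_adj p q p x y" and y: "odd y" for x v y
  proof -
    have "\<not> q dvd y" if "block_adj p q p 4 y"
      using \<open>q = 3 \<or> 7 \<le> q\<close>
    proof
      assume "q = 3"
      then show ?thesis using block_adj_4_b3[of p p y] that pq by auto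
    next
      assume "7 \<le> q"
      then show ?thesis
        using block_adj_lower[OF that] pq not_dvd_less_double[of y q] by auto
    qed
    moreover have "\<not> p dvd y" if "block_adj p q p 2 y"
      using block_adj_lower[OF that] \<open>q = 3 \<or> 7 \<le> q\<close> ne pq not_dvd_less_double[of y p] by auto
    moreover have "\<not> p dvd y" if "block_adj p q p (2 * q) y"
      using not_dvd_adj_2q[OF pq ne(4) that] .
    ultimately show ?thesis
      using that pq coprime_even_multiples[OF y] by auto
  qed
qed (use assms prime_gt_0_nat[OF pq(2)] in auto)

text \<open>Here \<open>p = 2 * q - 1\<close> is a neighbour of \<open>2 * q\<close>, so that place
  gets \<open>2\<close>, and \<open>2 * q\<close> goes to \<open>2 * p\<close>, whose neighbours are
  \<open>4 * q - 3\<close>, \<open>4 * q - 1\<close> and \<open>6 * q - 3\<close>.\<close>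

lemma labeling_p_eq_double_minus_one:
  fixes p q :: nat
  assumes pq: "prime p" "prime q" "odd q" "q < p"
    and ne: "5 \<le> q" "p + 1 = 2 * q"
  shows "\<exists>f. prime_labeling (ladder (2 * p + q)) f"
proof (rule labeling_large_p_base[OF pq,
      where ps = "[(2 * p, 2 * q), (4 * p, 4), (2 * q, 2), (2, 2 * p), (4, 4 * p)]"])
  \<comment> \<open>\<open>q = 5\<close> would make \<open>p = 9\<close> the neighbour
    \<open>q + 4\<close> of \<open>4\<close>.\<close>
  have "\<not> prime (9 :: nat)" by simp
  then have p: "p \<noteq> 9" using pq by auto
  show "coprime v y"
    if "(x, v) \<in> set [(2 * p, 2 * q), (4 * p, 4), (2 * q, 2), (2, 2 * p), (4, 4 * p)]"
      "block_adj p q p x y" and y: "odd y" for x v y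
  proof -
    have "\<not> p dvd y" if "block_adj p q p 2 y"
      using block_adj_lower[OF that] ne pq p not_dvd_less_double[of y p] by auto
    moreover have "\<not> p dvd y" if "block_adj p q p 4 y"
      using block_adj_lower[OF that] ne pq p not_dvd_less_double[of y p] by auto
    moreover have "\<not> q dvd y" if "block_adj p q p (2 * p) y"
    proof -
      have "y = 4 * q - 3 \<or> y = 4 * q - 1 \<or> y = 6 * q - 3"
        using block_adj_above_2b[OF that] ne by auto
      moreover from this have "0 < y" "y < 6 * q" using ne by auto
      ultimately show ?thesis
        using small_multiples[of q y] ne by auto
    qed
    ultimately show ?thesis
      using that pq coprime_even_multiples[OF y] by auto
  qed
qed (use assms in auto)

section \<open>The case \<open>p < q\<close>\<close>

text \<open>
  \<open>E\<close> is the even member of the column of two multiples of \<open>q\<close> among the labels above \<open>4p\<close>; these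
  two multiples are \<open>q, 2q\<close> or \<open>2q, 3q\<close> or \<open>3q, 4q\<close> or \<open>4q, 5q\<close>.
\<close>

lemma even_multiple_bounds:
  fixes p q :: nat
  assumes "prime q" "odd q" "p < q"
  defines "E \<equiv> (if 2 * p < q then 2 * q else 4 * q)"
  shows "even E" "4 * p < E" "E \<le> 4 * p + 2 * q"
    and "\<And>y. odd y \<Longrightarrow> \<not> q dvd y \<Longrightarrow> coprime E y"
proof -
  have "2 * p \<noteq> q" using assms(2) by auto
  then show "even E" "4 * p < E" "E \<le> 4 * p + 2 * q" using assms by auto
  show "coprime E y" if "odd y" "\<not> q dvd y" for y
    using coprime_even_multiples[OF that(1)] assms(1) that(2) by (simp add: E_def)
qed

text \<open>With lengths \<open>q\<close>, \<open>p\<close>, \<open>p\<close> the two short blocks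
  use the labels up to \<open>4 * p\<close> and have the bad columns \<open>p, 2 * p\<close> and
  \<open>3 * p, 4 * p\<close>; \<open>E\<close> settles the left block.\<close>

lemma labeling_large_q_base:
  fixes p q :: nat and ps :: "(nat \<times> nat) list"
  defines "S \<equiv> set (map fst ps)"
    and "E \<equiv> (if 2 * p < q then 2 * q else 4 * q)"
  assumes pq: "prime p" "prime q" "odd p" "p < q"
    and dist: "distinct (map fst ps)" and perm: "set (map snd ps) = S"
    and range: "\<And>x. x \<in> S \<Longrightarrow> even x \<and> 0 < x \<and> x \<le> 4 * p + 2 * q"
    and S: "2 * p \<in> S" "4 * p \<in> S" "E \<in> S"
    and moved: "\<And>x v y. (x, v) \<in> set ps \<Longrightarrow> block_adj q p p x y \<Longrightarrow> odd y \<Longrightarrow> coprime v y"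
  shows "\<exists>f. prime_labeling (ladder (2 * p + q)) f"
proof -
  have "odd q" using pq prime_odd_nat[of q] prime_gt_1_nat[of p] by simp
  then have "2 * p \<noteq> q" by auto
  have "\<exists>f. prime_labeling (ladder (q + p + p)) f"
  proof (rule prime_labelingI_shifts[where ps = ps])
    show "x \<in> set (map fst ps) \<or> x + p \<in> set (map fst ps)"
      if "0 < x" "x \<le> p" "\<not> coprime x p" for x
      using that small_multiples[OF prime_dvd_if_not_coprime[OF pq(1) that(3)]] S
      by (auto simp: S_def mult_2)
    show "x \<in> set (map fst ps) \<or> x + p \<in> set (map fst ps)"
      if "2 * p < x" "x \<le> 2 * p + p" "\<not> coprime x p" for x
    proof -
      have "x = 3 * p"
        using that small_multiples[OF prime_dvd_if_not_coprime[OF pq(1) that(3)]] by auto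
      moreover have "3 * p + p = 4 * p" by simp
      ultimately show ?thesis using S by (metis S_def)
    qed
    show "x \<in> set (map fst ps) \<or> x + q \<in> set (map fst ps)"
      if "2 * p + 2 * p < x" "x \<le> 2 * p + 2 * p + q" "\<not> coprime x q" for x
    proof -
      have "x \<in> {q, 2 * q, 3 * q, 4 * q, 5 * q}"
        using that pq by (intro small_multiples prime_dvd_if_not_coprime) auto
      then have "x = E \<or> x + q = E"
        using that pq \<open>2 * p \<noteq> q\<close> by (auto simp: E_def)
      then show ?thesis using S by (auto simp: S_def)
    qed
    have "coprime p q" using pq primes_coprime[of p q] by auto
    then have "coprime p (q + p)" by (simp add: coprime_iff_gcd_eq_1 add.commute[of q p])
    then show "coprime p (q + p) \<or> 2 * (q + p + p) \<in> set (map fst ps)" ..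
    show "coprime (2 * p) (2 * p + 2 * p + q) \<or> 2 * p \<in> set (map fst ps)"
      using S by (simp add: S_def)
    show "even x \<and> 0 < x \<and> x \<le> 2 * (q + p + p)" if "x \<in> set (map fst ps)" for x
      using range[of x] that by (simp add: S_def)
  qed (use pq \<open>odd q\<close> dist perm moved in \<open>simp_all add: S_def\<close>)
  then show ?thesis by (simp add: mult_2 add_ac)
qed

section \<open>Neighbours of further labels and relabelings for \<open>p < q\<close>\<close>

lemma block_adj_8_b5:
  assumes "block_adj a 5 c 8 y" "0 < c"
  shows "y \<in> {3, 7, 9}"
  using assms(1) unfolding block_adj_def
proof
  assume "block_arc a 5 c 8 y"
  then show ?thesis using assms(2-) by cases auto
next
  assume "block_arc a 5 c y 8"
  then show ?thesis using assms(2-) by cases auto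
qed

lemma block_adj_2b_2c:
  assumes "block_adj a b c (2 * b + 2 * c) y" "0 < a" "0 < b" "1 < c"
  shows "y \<in> {2 * b + c, 2 * b + 2 * c - 1}"
  using assms(1) unfolding block_adj_def
proof
  assume "block_arc a b c (2 * b + 2 * c) y"
  then show ?thesis using assms(2-) by cases auto
next
  assume "block_arc a b c y (2 * b + 2 * c)"
  then show ?thesis using assms(2-) by cases auto
qed

lemma block_adj_2b_c:
  assumes "block_adj a b c (2 * b + c + 1) y" "0 < b" "1 < c"
  shows "y \<in> {1, 2 * b + 1, 2 * b + c + 2}"
  using assms(1) unfolding block_adj_def
proof
  assume "block_arc a b c (2 * b + c + 1) y"
  then show ?thesis using assms(2-) by cases auto
next
  assume "block_arc a b c y (2 * b + c + 1)"
  then show ?thesis using assms(2-) by cases auto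
qed

text \<open>The case \<open>b = 1\<close>, where \<open>b + 1 = 2 * b\<close> meets both seams,
  accounts for the last two entries.\<close>

lemma block_adj_b:
  assumes "block_adj a b c (b + 1) y" "0 < b" "0 < c"
  shows "y \<in> {1, b + 2, 2 * b + 1, b, 2 * b + 2 * c + a}"
  using assms(1) unfolding block_adj_def
proof
  assume "block_arc a b c (b + 1) y"
  then show ?thesis using assms(2-) by cases auto
next
  assume "block_arc a b c y (b + 1)"
  then show ?thesis using assms(2-) by cases auto
qed

text \<open>Finds a place for \<open>4 * p\<close>: the neighbours \<open>3, 5, p + 4\<close> of
  \<open>4\<close> are suitable unless \<open>p = 5\<close>, and then \<open>8\<close> has
  neighbours \<open>3, 7, 9\<close>.\<close>

lemma obtain_power_of_2_place:
  fixes p :: nat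
  assumes "prime p" "5 \<le> p"
  obtains t where "t = 4 \<or> t = 8" "t < 2 * p" "\<And>a y. block_adj a p p t y \<Longrightarrow> \<not> p dvd y"
proof (cases "p = 5")
  case True
  have "\<not> p dvd y" if "block_adj a p p 8 y" for a y
    using block_adj_8_b5[of a p y] that True by auto
  then show ?thesis using that[of 8] True by auto
next
  case False
  have "\<not> p dvd y" if "block_adj a p p 4 y" for a y
    using block_adj_lower[OF that] False assms not_dvd_less_double[of y p] by auto
  then show ?thesis using that[of 4] assms by auto
qed

lemma labeling_large_q:
  fixes p q :: nat
  assumes pq: "prime p" "prime q" "odd p" "p < q" and "5 \<le> p"
  shows "\<exists>f. prime_labeling (ladder (2 * p + q)) f"
proof -
  have "odd q" using pq prime_odd_nat[of q] prime_gt_1_nat[of p] by simp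
  define E where "E = (if 2 * p < q then 2 * q else 4 * q)"
  note E = even_multiple_bounds[OF pq(2) \<open>odd q\<close> pq(4), folded E_def]
  obtain t where t: "t = 4 \<or> t = 8" "t < 2 * p" "\<And>a y. block_adj a p p t y \<Longrightarrow> \<not> p dvd y"
    using obtain_power_of_2_place pq(1) \<open>5 \<le> p\<close> by blast
  have tE: "coprime t y" if "odd y" for y using t(1) coprime_even_multiples[OF that] by auto
  have N2: "\<not> p dvd y" if "block_adj q p p 2 y" for y
    using block_adj_lower[OF that] \<open>5 \<le> p\<close> not_dvd_less_double[of y p] by auto
  show ?thesis
  proof (cases "q + 1 = 2 * p")
    \<comment> \<open>The value \<open>E\<close> goes to \<open>2 * p\<close>, whose neighbours are
      \<open>p\<close>, \<open>2 * p - 1\<close> and \<open>4 * p + q\<close>.\<close>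
    case False
    have N: "\<not> q dvd y" if "block_adj q p p (2 * p) y" for y
    proof -
      have "\<not> q dvd 4" "\<not> q dvd p"
        using pq \<open>5 \<le> p\<close> by (intro not_dvd_less_double; simp)+
      then have "\<not> q dvd 4 * p" using pq by (metis prime_dvd_mult_nat)
      then have "\<not> q dvd 2 * p + 2 * p + q" by simp
      moreover have "2 * p - 1 \<noteq> q" using False \<open>5 \<le> p\<close> by linarith
      then have "\<not> q dvd 2 * p - 1" using pq \<open>5 \<le> p\<close> by (intro not_dvd_less_double) auto
      moreover have "y \<in> {p, 2 * p - 1, 2 * p + 2 * p + q}"
        using block_adj_2b[OF that] \<open>5 \<le> p\<close> by simp
      ultimately show ?thesis using \<open>\<not> q dvd p\<close> by auto
    qed
    show ?thesis
    proof (rule labeling_large_q_base[OF pq,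
        where ps = "[(2 * p, E), (4 * p, t), (E, 2), (2, 2 * p), (t, 4 * p)]"])
      show "coprime v y"
        if "(x, v) \<in> set [(2 * p, E), (4 * p, t), (E, 2), (2, 2 * p), (t, 4 * p)]"
          "block_adj q p p x y" and y: "odd y" for x v y
        using that(1,2) N N2 t(3) tE[OF y] E(4)[OF y] pq coprime_even_multiples[OF y] by auto
    qed (use E t(1,2) \<open>5 \<le> p\<close> in \<open>auto simp flip: E_def\<close>)
  next
    \<comment> \<open>Now \<open>q = 2 * p - 1\<close> is a neighbour of \<open>2 * p\<close>, so
      \<open>E\<close> goes to the corner \<open>4 * p\<close>, with neighbours \<open>3 * p\<close>
      and \<open>4 * p - 1 = 2 * q + 1\<close>.\<close>
    case True
    have N: "\<not> q dvd y" if "block_adj q p p (4 * p) y" for y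
    proof -
      have "y \<in> {3 * p, 4 * p - 1}"
        using block_adj_2b_2c[of q p p y] that pq \<open>5 \<le> p\<close> by auto
      then have "y = 3 * p \<or> y = 4 * p - 1" by simp
      moreover from this have "0 < y" "y < 6 * q" using True \<open>5 \<le> p\<close> by auto
      ultimately show ?thesis
        using small_multiples[of q y] True \<open>5 \<le> p\<close> by auto
    qed
    show ?thesis
    proof (rule labeling_large_q_base[OF pq,
        where ps = "[(2 * p, t), (4 * p, E), (E, 2), (2, 2 * p), (t, 4 * p)]"])
      show "coprime v y"
        if "(x, v) \<in> set [(2 * p, t), (4 * p, E), (E, 2), (2, 2 * p), (t, 4 * p)]"
          "block_adj q p p x y" and y: "odd y" for x v y
        using that(1,2) N N2 t(3) tE[OF y] E(4)[OF y] pq coprime_even_multiples[OF y] by auto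
    qed (use E t(1,2) \<open>5 \<le> p\<close> in \<open>auto simp flip: E_def\<close>)
  qed
qed


text \<open>Place \<open>2\<close> is adjacent to \<open>3\<close>, so the values \<open>6\<close>
  and \<open>12\<close> go to \<open>4\<close> and \<open>10\<close>, with neighbours
  \<open>1, 5, 7\<close> and \<open>1, 7, 11\<close>.\<close>

lemma labeling_p_eq_3:
  fixes q :: nat
  assumes q: "prime q" "7 \<le> q"
  shows "\<exists>f. prime_labeling (ladder (2 * 3 + q)) f"
proof -
  have pq: "prime (3 :: nat)" "prime q" "odd (3 :: nat)" "3 < q" using q by simp_all
  have "odd q" using q prime_odd_nat by simp
  define E where "E = (if 2 * 3 < q then 2 * q else 4 * q)"
  note E = even_multiple_bounds[OF pq(2) \<open>odd q\<close> pq(4), folded E_def]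
  have N4: "coprime 6 y" if "block_adj q 3 3 4 y" "odd y" for y
    using block_adj_4_b3[of q 3 y] that coprime_even_multiples(4)[of y 3] by auto
  have N6: "coprime E y" if "block_adj q 3 3 6 y" "odd y" for y
  proof -
    have "\<not> q dvd 3" "\<not> q dvd 4" using q by (intro not_dvd_less_double; simp)+
    then have "\<not> q dvd 3 * 4" using pq(2) by (metis prime_dvd_mult_nat)
    then have "\<not> q dvd 12 + q" by simp
    moreover have "\<not> q dvd 5" using q by (intro not_dvd_less_double) auto
    moreover have "y \<in> {3, 5, 12 + q}"
      using block_adj_2b[of q 3 3 y] that(1) by simp
    ultimately show ?thesis using E(4)[OF that(2)] \<open>\<not> q dvd 3\<close> by auto
  qed
  have N10: "coprime 12 y" if "block_adj q 3 3 10 y" "odd y" for y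
  proof -
    have "y \<in> {1, 7, 11}"
      using block_adj_2b_c[of q 3 3 y] that(1) by simp
    then show ?thesis using coprime_even_multiples(5)[OF that(2), of 3] by auto
  qed
  have N12: "coprime 10 y" if "block_adj q 3 3 12 y" "odd y" for y
    using block_adj_2b_2c[of q 3 3 y] that coprime_even_multiples(4)[OF that(2), of 5] q by auto
  show ?thesis
  proof (rule labeling_large_q_base[OF pq,
      where ps = "[(12, 10), (10, 12), (4, 6), (E, 4), (6, E)]"])
    show "coprime v y"
      if "(x, v) \<in> set [(12, 10), (10, 12), (4, 6), (E, 4), (6, E)]"
        "block_adj q 3 3 x y" and y: "odd y" for x v y
      using that(1,2) N4 N6 N10 N12 y coprime_even_multiples(2)[OF y] by auto
  qed (use E q in \<open>auto simp: E_def\<close>)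
qed

text \<open>Block lengths have to be odd, so \<open>1\<close> and \<open>3\<close> replace two
  blocks of length \<open>2\<close>. The bad columns are \<open>3, 6\<close> and
  \<open>q, 2 * q\<close>; the latter lies in the left block since \<open>8 < q\<close>.\<close>

lemma labeling_p_eq_2:
  fixes q :: nat
  assumes q: "prime q" "11 \<le> q"
  shows "\<exists>f. prime_labeling (ladder (2 * 2 + q)) f"
proof -
  let ?ps = "[(2 * q, 8), (6, 2 * q), (8, 6)] :: (nat \<times> nat) list"
  have "odd q" using q prime_odd_nat by simp
  have "\<exists>f. prime_labeling (ladder (q + 1 + 3)) f"
  proof (rule prime_labelingI_shifts[where ps = "?ps"])
    show "coprime v y"
      if "(x, v) \<in> set ?ps"
        "block_adj q 1 3 x y" and y: "odd y" for x v y
    proof -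
      have "\<not> q dvd y" if "block_adj q 1 3 6 y"
      proof -
        have "y \<in> {1, 3, 7}"
          using block_adj_2b_c[of q 1 3 y] that by simp
        then show ?thesis using q not_dvd_less_double[of y q] by auto
      qed
      moreover have "\<not> 3 dvd y" if "block_adj q 1 3 8 y"
        using block_adj_2b_2c[of q 1 3 y] that q by auto
      ultimately show ?thesis
        using that q coprime_even_multiples[OF y] coprime_even_multiples(4)[OF y, of 3] by auto
    qed
    show "x \<in> set (map fst ?ps) \<or>
        x + 3 \<in> set (map fst ?ps)"
      if "2 * 1 < x" "x \<le> 2 * 1 + 3" "\<not> coprime x 3" for x :: nat
      using small_multiples[of 3 x] prime_dvd_if_not_coprime[of 3 x] that by auto
    show "x \<in> set (map fst ?ps) \<or>
        x + q \<in> set (map fst ?ps)"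
      if "2 * 1 + 2 * 3 < x" "x \<le> 2 * 1 + 2 * 3 + q" "\<not> coprime x q" for x
      using small_multiples[of q x] prime_dvd_if_not_coprime[of q x] that q by auto
  qed (use q \<open>odd q\<close> in auto)
  then show ?thesis by (simp add: add_ac)
qed

section \<open>The remaining cases\<close>

lemma block_adj_last:
  assumes "block_adj a b c (2 * (a + b + c)) y" "0 < a" "0 < b" "0 < c"
  shows "y \<in> {2 * (a + b + c) - 1, a + 2 * b + 2 * c, b}"
  using assms(1) unfolding block_adj_def
proof
  assume "block_arc a b c (2 * (a + b + c)) y"
  then show ?thesis using assms(2-) by cases auto
next
  assume "block_arc a b c y (2 * (a + b + c))"
  then show ?thesis using assms(2-) by cases auto
qed

text \<open>The bad columns are \<open>p, 2 * p\<close>, then \<open>3 * p, 4 * p\<close>, then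
  \<open>5 * p, 6 * p\<close>; moving \<open>2 * p\<close> and \<open>6 * p\<close> also clears the
  left seam. \<open>11 \<le> p\<close> keeps \<open>p\<close> away from the neighbours
  \<open>5\<close> and \<open>7\<close> of \<open>6\<close>, and the factor \<open>3\<close> of
  \<open>6\<close> is checked separately.\<close>

lemma labeling_p_eq_q:
  fixes p :: nat
  assumes p: "prime p" "11 \<le> p"
  shows "\<exists>f. prime_labeling (ladder (2 * p + p)) f"
proof -
  have "odd p" using p prime_odd_nat by simp
  let ?ps = "[(2, 2 * p), (2 * p, 2), (4, 4 * p), (4 * p, 4), (6, 6 * p), (6 * p, 6)]"
  have coprime_6: "coprime 6 y" if "odd y" "\<not> 3 dvd y" for y :: nat
    using coprime_even_multiples(4)[of y 3] that by simp
  have "\<not> 3 dvd p" using p primes_dvd_imp_eq[of 3 p] by auto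
  have "\<exists>f. prime_labeling (ladder (p + p + p)) f"
  proof (rule prime_labelingI_shifts[where ps = ?ps])
    show "coprime v y"
      if "(x, v) \<in> set ?ps" "block_adj p p p x y" and y: "odd y" for x v y
    proof -
      have "\<not> p dvd y" if "block_adj p p p 2 y"
        using block_adj_lower[OF that] p not_dvd_less_double[of y p] by auto
      moreover have "\<not> p dvd y" if "block_adj p p p 4 y"
        using block_adj_lower[OF that] p not_dvd_less_double[of y p] by auto
      moreover have "coprime (6 * p) y" if "block_adj p p p 6 y"
      proof -
        have *: "y \<in> {5, 7, 6 + p}" using block_adj_lower[OF that] p by simp
        then have "\<not> p dvd y" using p not_dvd_less_double[of y p] by auto
        moreover have "\<not> 3 dvd 6 + p" using \<open>\<not> 3 dvd p\<close> dvd_add_right_iff[of 3 6 p] by simp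
        then have "\<not> 3 dvd y" using * by auto
        ultimately show ?thesis using coprime_6 y p by (simp add: prime_imp_coprime)
      qed
      moreover have "coprime 6 y" if "block_adj p p p (6 * p) y"
      proof -
        have "y \<in> {6 * p - 1, 5 * p, p}"
          using block_adj_last[of p p p y] that p by simp
        moreover have "\<not> 3 dvd 5 * p"
          using \<open>\<not> 3 dvd p\<close> prime_dvd_mult_nat[of 3 5 p] by auto
        moreover have "\<not> 3 dvd 6 * p - 1" using p by presburger
        ultimately show ?thesis using coprime_6 y \<open>\<not> 3 dvd p\<close> by auto
      qed
      ultimately show ?thesis
        using that p coprime_even_multiples[OF y] by auto
    qed
    show "x \<in> set (map fst ?ps) \<or> x + p \<in> set (map fst ?ps)"
      if "0 < x" "x \<le> p" "\<not> coprime x p" for x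
      using small_multiples[of p x] prime_dvd_if_not_coprime[of p x] that p by auto
    show "x \<in> set (map fst ?ps) \<or> x + p \<in> set (map fst ?ps)"
      if "2 * p < x" "x \<le> 2 * p + p" "\<not> coprime x p" for x
      using small_multiples[of p x] prime_dvd_if_not_coprime[of p x] that p by auto
    show "x \<in> set (map fst ?ps) \<or> x + p \<in> set (map fst ?ps)"
      if "2 * p + 2 * p < x" "x \<le> 2 * p + 2 * p + p" "\<not> coprime x p" for x
      using small_multiples[of p x] prime_dvd_if_not_coprime[of p x] that p by auto
  qed (use p \<open>odd p\<close> in auto)
  then show ?thesis by (simp add: mult_2)
qed

text \<open>With lengths \<open>1, 1, r\<close> the only bad column is \<open>r, 2 * r\<close>; the
  value \<open>2 * r\<close> fits at \<open>2\<close>, whose neighbours are \<open>1\<close>,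
  \<open>3\<close> and \<open>2 * r + 3\<close>.\<close>

lemma labeling_prime_plus_2:
  fixes r :: nat
  assumes r: "prime r" "5 \<le> r"
  shows "\<exists>f. prime_labeling (ladder (r + 2)) f"
proof -
  let ?ps = "[(2, 2 * r), (2 * r, 2)] :: (nat \<times> nat) list"
  have "odd r" using r prime_odd_nat by simp
  have "\<exists>f. prime_labeling (ladder (1 + 1 + r)) f"
  proof (rule prime_labelingI_shifts[where ps = "?ps"])
    show "coprime v y"
      if "(x, v) \<in> set ?ps" "block_adj 1 1 r x y" and y: "odd y" for x v y
    proof -
      have "\<not> r dvd y" if "block_adj 1 1 r 2 y"
      proof -
        have "y \<in> {1, 3, 2 * r + 3}"
          using block_adj_b[of 1 1 r y] that r by (auto simp: numeral_eq_Suc)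
        moreover have "\<not> r dvd 3" using r by (intro not_dvd_less_double) auto
        then have "\<not> r dvd 2 * r + 3" using dvd_add_right_iff[of r "2 * r" 3] by simp
        ultimately show ?thesis using r \<open>\<not> r dvd 3\<close> by auto
      qed
      then show ?thesis using that r coprime_even_multiples[OF y] by auto
    qed
    show "x \<in> set (map fst ?ps) \<or>
        x + r \<in> set (map fst ?ps)"
      if "2 * 1 < x" "x \<le> 2 * 1 + r" "\<not> coprime x r" for x
      using small_multiples[of r x] prime_dvd_if_not_coprime[of r x] that r by auto
  qed (use r \<open>odd r\<close> in auto)
  then show ?thesis by simp
qed

text \<open>The relabeling was found by computer search.\<close>

lemma labeling_11: "\<exists>f. prime_labeling (ladder 11) f"
proof -
  \<comment> \<open>Here \<open>11 - 2\<close> is not prime. The lengths \<open>3, 7, 1\<close> give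
    the bad columns \<open>7, 14\<close> and \<open>18, 21\<close>.\<close>
  let ?ps = "[(2, 14), (14, 18), (18, 2)] :: (nat \<times> nat) list"
  have "\<exists>f. prime_labeling (ladder (3 + 7 + 1)) f"
  proof (rule prime_labelingI_shifts[where ps = "?ps"])
    show "coprime v y"
      if "(x, v) \<in> set ?ps" "block_adj 3 7 1 x y" and y: "odd y" for x v y
    proof -
      have "\<not> 7 dvd y" if "block_adj 3 7 1 2 y"
        using block_adj_lower[OF that] by auto
      moreover have "coprime 18 y" if "block_adj 3 7 1 14 y"
      proof -
        have "\<not> 3 dvd y" using block_adj_2b[of 3 7 1 y] that by auto
        then have "coprime (2 * 3 * 3) y"
          using y by (simp only: coprime_mult_left_iff) (simp add: prime_imp_coprime)
        then show ?thesis by simp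
      qed
      ultimately show ?thesis
        using that coprime_even_multiples[OF y] coprime_even_multiples(4)[OF y, of 7] by auto
    qed
    show "x \<in> set (map fst ?ps) \<or>
        x + 7 \<in> set (map fst ?ps)"
      if "0 < x" "x \<le> 7" "\<not> coprime x 7" for x :: nat
      using small_multiples[of 7 x] prime_dvd_if_not_coprime[of 7 x] that by auto
    show "x \<in> set (map fst ?ps) \<or>
        x + 3 \<in> set (map fst ?ps)"
      if "2 * 7 + 2 * 1 < x" "x \<le> 2 * 7 + 2 * 1 + 3" "\<not> coprime x 3" for x :: nat
    proof -
      have "3 dvd x" using prime_dvd_if_not_coprime[of 3 x] that by simp
      then have "x = 18" using that by presburger
      then show ?thesis by simp
    qed
    have "coprime 4 (7 :: nat)" using coprime_even_multiples(2)[of 7] by simp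
    then show "coprime 7 (3 + 1 :: nat) \<or> 2 * (3 + 7 + 1) \<in> set (map fst ?ps)"
      by (simp add: coprime_commute)
  qed auto
  then show ?thesis by simp
qed

theorem theorem3:
  fixes n p q :: nat
  assumes "prime p"
    and "prime q" and "odd q"
    and "n = 2 * p + q"
  shows "\<exists>f. prime_labeling (ladder n) f"
proof -
  note pq = assms(1-3)
  have not_prime: "\<not> prime (9 :: nat)" by simp
  have "3 \<le> q" using pq prime_gt_1_nat[of q] by (auto, presburger)
  have "2 \<le> p" using pq prime_ge_2_nat by blast
  \<comment> \<open>These values come from the small pairs \<open>p\<close>, \<open>q\<close>
    outside the lemmas above; all but \<open>11\<close> are \<open>r + 2\<close> with
    \<open>r\<close> prime.\<close>
  have exceptional: ?thesis if "n \<in> {7, 9, 11, 13, 15, 21}"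
    using that labeling_11 labeling_prime_plus_2[of 5] labeling_prime_plus_2[of 7]
      labeling_prime_plus_2[of 11] labeling_prime_plus_2[of 13] labeling_prime_plus_2[of 19]
    by auto
  consider "q < p" | "p = q" | "p < q" by linarith
  then have "\<exists>f. prime_labeling (ladder (2 * p + q)) f"
  proof cases
    case 1
    have "odd p" using pq 1 \<open>3 \<le> q\<close> prime_odd_nat[of p] by simp
    have "q = 3 \<or> 5 \<le> q" using \<open>3 \<le> q\<close> pq(3) by presburger
    moreover have "p = 5 \<or> 7 \<le> p" if "q = 3" using that 1 \<open>odd p\<close> by presburger
    ultimately consider "q = 3" "p = 5" | "q = 3" "7 \<le> p" | "5 \<le> q" by blast
    then show ?thesis
    proof cases
      case 1
      then show ?thesis using exceptional assms(4) by simp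
    next
      case 2
      then show ?thesis using labeling_near_large_p[of p q] pq by simp
    next
      case 3
      consider "p + 1 = 2 * q" | "p = q + 4" | "p \<noteq> q + 4" "p + 1 \<noteq> 2 * q" by blast
      then show ?thesis
      proof cases
        case 1
        then show ?thesis
          using labeling_p_eq_double_minus_one[OF pq(1-3) \<open>q < p\<close> \<open>5 \<le> q\<close>] by simp
      next
        case 2
        \<comment> \<open>\<open>q = 5\<close> would give \<open>p = 9\<close>; its exclusion also
          ensures \<open>p + 1 \<noteq> 2 * q\<close>.\<close>
        then have "q \<noteq> 5" using pq(1) not_prime by auto
        then show ?thesis
          using labeling_near_large_p[OF pq(1-3) \<open>q < p\<close>] 2 3 by simp
      next
        case 3
        then show ?thesis
          using labeling_generic_large_p[OF pq(1-3) \<open>q < p\<close> \<open>5 \<le> q\<close>] by simp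
      qed
    qed
  next
    case 2
    have "p = 3 \<or> p = 5 \<or> p = 7 \<or> p = 9 \<or> 11 \<le> p"
      using pq(3) \<open>3 \<le> q\<close> unfolding 2 by presburger
    then have "n \<in> {9, 15, 21} \<or> 11 \<le> p" using assms(1,4) 2 not_prime by auto
    then show ?thesis
    proof
      assume "n \<in> {9, 15, 21}"
      then show ?thesis using exceptional assms(4) by auto
    next
      assume "11 \<le> p"
      then show ?thesis using labeling_p_eq_q[OF pq(1)] 2 by simp
    qed
  next
    case 3
    consider "p = 2" "q \<in> {3, 5, 7}" | "p = 2" "11 \<le> q" | "p = 3" "q = 5" | "p = 3" "7 \<le> q"
      | "odd p" "5 \<le> p"
    proof -
      have "p = 2 \<or> odd p" using pq(1) \<open>2 \<le> p\<close> prime_odd_nat[of p] by auto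
      then have "p = 2 \<or> p = 3 \<or> odd p \<and> 5 \<le> p" using \<open>2 \<le> p\<close> by presburger
      moreover have "q = 3 \<or> q = 5 \<or> q = 7 \<or> q = 9 \<or> 11 \<le> q"
        using pq(3) \<open>3 \<le> q\<close> by presburger
      then have "q \<in> {3, 5, 7} \<or> 11 \<le> q" using pq(2) not_prime by auto
      ultimately show ?thesis using that 3 by auto
    qed
    then show ?thesis
    proof cases
      case 1
      then show ?thesis using exceptional assms(4) by auto
    next
      case 2
      then show ?thesis using labeling_p_eq_2[of q] pq by simp
    next
      case 3
      then show ?thesis using exceptional assms(4) by simp
    next
      case 4
      then show ?thesis using labeling_p_eq_3[of q] pq by simp
    next
      case 5
      then show ?thesis using labeling_large_q[of p q] pq 3 \<open>p < q\<close> by simp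
    qed
  qed
  then show ?thesis using assms(4) by simp
qed

end
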